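(* Let $\mathcal{T}_i=(\mathcal{S}_i,\mathcal{S}^{init}_i,\mathcal{U}_i,\mathcal{P},\Delta_i,\mathcal{L}_i,\mathcal{W}_i)$, $i=1,2$, be two weighted transition systems, let $\Pi$ be a property over the set of propositions $\mathcal{P}$, let $\mathcal{T}_1\preceq_{(\alpha,\beta)}\mathcal{T}_2$, and let $(s_0,s_0')\in\alpha$ with $s_0\in\mathcal{S}^{init}_1$ and $s_0'\in\mathcal{S}^{init}_2$. If there exists a winning strategy $\sigma_2$ for $\mathcal{T}_2$ from $s_0'$ with respect to $\Pi$, then there exists a winning strategy $\sigma_1$ for $\mathcal{T}_1$ from $s_0$ with respect to $\Pi$ such that $\mathcal{W}_1(\mathcal{T}_1,\sigma_1,s_0)\le\mathcal{W}_2(\mathcal{T}_2,\sigma_2,s_0')$. Hence, $\mathcal{W}_1(\mathcal{T}_1,s_0,\Pi)\le\mathcal{W}_2(\mathcal{T}_2,s_0',\Pi)$.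
   Context: Weighted transition system: a tuple $\mathcal{T}=(\mathcal{S},\mathcal{S}^{init},\mathcal{U},\mathcal{P},\Delta,\mathcal{L},\mathcal{W})$ with states $\mathcal{S}$, initial states $\mathcal{S}^{init}\subseteq\mathcal{S}$, control inputs $\mathcal{U}$, propositions $\mathcal{P}$, transition relation $\Delta\subseteq\mathcal{S}\times\mathcal{U}\times\mathcal{S}$, labeling $\mathcal{L}:\mathcal{S}\to\mathcal{P}$, and cost $\mathcal{W}:\mathcal{S}\times\mathcal{U}\times\mathcal{S}\to\mathbb{R}_+$ ($\mathbb{R}_+$ the non-negative reals). $Enabled(s)=\{u\in\mathcal{U}:\exists s',\ (s,u,s')\in\Delta\}$. Paths and properties: a path is a sequence $\zeta=s_0u_0s_1u_1\dots$ with $s_0\in\mathcal{S}^{init}$ and $(s_i,u_i,s_{i+1})\in\Delta$; finite paths end in a state, and $Paths(\mathcal{T})$ is the set of finite paths. Its trace is $Tr(\zeta)=\mathcal{L}(s_0)\mathcal{L}(s_1)\dots$ and its cost is $\mathcal{W}(\zeta)=\sum_j\mathcal{W}(s_j,u_j,s_{j+1})$. A property over $\mathcal{P}$ is a set of finite sequences over $\mathcal{P}$. Strategies: a strategy is a partial function $\sigma:Paths(\mathcal{T})\to\mathcal{U}$ with $\sigma(s_0u_0\dots s_i)\in Enabled(s_i)$ where defined. A path $s_0u_0s_1\dots$ conforms to $\sigma$ if $\sigma(s_0u_0\dots s_i)=u_i$ for all $i$. A finite path maximally conforms to $\sigma$ if it conforms and no one-step extension of it conforms. $Paths^m_\sigma(\mathcal{T},s_0)$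 is the set of maximally conforming finite paths starting at $s_0$. $Str(\mathcal{T})$ is the set of strategies to which no infinite path conforms. $\sigma$ is winning from $s_0$ with respect to $\Pi$ if $\sigma\in Str(\mathcal{T})$ and $Tr(Paths^m_\sigma(\mathcal{T},s_0))\subseteq\Pi$. Its cost is $\mathcal{W}(\mathcal{T},\sigma,s_0)=\sup\{\mathcal{W}(\zeta):\zeta\in Paths^m_\sigma(\mathcal{T},s_0)\}$ (possibly $\infty$). The optimal cost of winning is $\mathcal{W}(\mathcal{T},s_0,\Pi)=\inf\{\mathcal{W}(\mathcal{T},\sigma,s_0):\sigma\text{ winning from }s_0\text{ w.r.t. }\Pi\}$, equal to $\infty$ if there is no winning strategy. For $\mathcal{T}_i$ these are written with $\mathcal{W}_i$. Simulation: $(\alpha,\beta)$ with $\alpha\subseteq\mathcal{S}_1\times\mathcal{S}_2$, $\beta\subseteq\mathcal{S}_1\times\mathcal{U}_1\times\mathcal{S}_2\times\mathcal{U}_2$ is a simulation from $\mathcal{T}_1$ to $\mathcal{T}_2$, written $\mathcal{T}_1\preceq_{(\alpha,\beta)}\mathcal{T}_2$, if: (1) $\mathcal{L}_1(s_1)=\mathcal{L}_2(s_2)$ for all $(s_1,s_2)\in\alpha$; (2) for every $s_1\in\mathcal{S}_1^{init}$ there is $s_2\in\mathcal{S}_2^{init}$ with $(s_1,s_2)\in\alpha$; (3) for every $(s_1,s_2)\in\alpha$ and $u_2\in Enabled(s_2)$ there is $u_1\in Enabled(s_1)$ such that (a) $(s_1,u_1,s_2,u_2)\in\beta$, and (b)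 for every $(s_1,u_1,s_1')\in\Delta_1$ there is $(s_2,u_2,s_2')\in\Delta_2$ with $(s_1',s_2')\in\alpha$ and $\mathcal{W}_1(s_1,u_1,s_1')\le\mathcal{W}_2(s_2,u_2,s_2')$. *)

theory Defs
  imports Complex_Main "HOL-Library.FuncSet" "HOL-Library.Extended_Real"
begin

record ('s, 'u, 'p) wts =
  wts_states :: "'s set"
  wts_init   :: "'s set"
  wts_inputs :: "'u set"
  wts_props  :: "'p set"
  wts_trans  :: "('s \<times> 'u \<times> 's) set"
  wts_label  :: "'s \<Rightarrow> 'p"
  wts_cost   :: "'s \<times> 'u \<times> 's \<Rightarrow> real"

definition weighted_transition_system :: "('s, 'u, 'p) wts \<Rightarrow> bool" where
  "weighted_transition_system T \<longleftrightarrow>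
     wts_init T \<subseteq> wts_states T \<and>
     wts_trans T \<subseteq> wts_states T \<times> wts_inputs T \<times> wts_states T \<and>
     wts_label T \<in> wts_states T \<rightarrow> wts_props T \<and>
     wts_cost T \<in> wts_states T \<times> wts_inputs T \<times> wts_states T \<rightarrow> {0..}"

definition enabled :: "('s, 'u, 'p) wts \<Rightarrow> 's \<Rightarrow> 'u set" where
  "enabled T s = {u \<in> wts_inputs T. \<exists>s'. (s, u, s') \<in> wts_trans T}"

text \<open>The sequence $s_0 u_0 s_1 u_1 \ldots u_{n-1} s_n$ is encoded as
  $(s_0, [(u_0, s_1), \ldots, (u_{n-1}, s_n)])$; thus it always ends in a state, and
  $(s_0, [])$ is the path consisting of the single state $s_0$.\<close>

type_synonym ('s, 'u) fpath = "'s \<times> ('u \<times> 's) list"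

definition path_length :: "('s, 'u) fpath \<Rightarrow> nat" where
  "path_length \<zeta> = length (snd \<zeta>)"

definition path_states :: "('s, 'u) fpath \<Rightarrow> 's list" where
  "path_states \<zeta> = fst \<zeta> # map snd (snd \<zeta>)"

definition path_inputs :: "('s, 'u) fpath \<Rightarrow> 'u list" where
  "path_inputs \<zeta> = map fst (snd \<zeta>)"

definition path_step :: "('s, 'u) fpath \<Rightarrow> nat \<Rightarrow> 's \<times> 'u \<times> 's" where
  "path_step \<zeta> i = (path_states \<zeta> ! i, path_inputs \<zeta> ! i, path_states \<zeta> ! Suc i)"

definition path_prefix :: "nat \<Rightarrow> ('s, 'u) fpath \<Rightarrow> ('s, 'u) fpath" where
  "path_prefix i \<zeta> = (fst \<zeta>, take i (snd \<zeta>))"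

definition path_extend :: "('s, 'u) fpath \<Rightarrow> 'u \<Rightarrow> 's \<Rightarrow> ('s, 'u) fpath" where
  "path_extend \<zeta> u s = (fst \<zeta>, snd \<zeta> @ [(u, s)])"

definition paths :: "('s, 'u, 'p) wts \<Rightarrow> ('s, 'u) fpath set" where
  "paths T = {\<zeta>. fst \<zeta> \<in> wts_init T \<and>
                  (\<forall>i < path_length \<zeta>. path_step \<zeta> i \<in> wts_trans T)}"

definition trace :: "('s, 'u, 'p) wts \<Rightarrow> ('s, 'u) fpath \<Rightarrow> 'p list" where
  "trace T \<zeta> = map (wts_label T) (path_states \<zeta>)"

definition path_cost :: "('s, 'u, 'p) wts \<Rightarrow> ('s, 'u) fpath \<Rightarrow> real" where
  "path_cost T \<zeta> = (\<Sum>j < path_length \<zeta>. wts_cost T (path_step \<zeta> j))"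

text \<open>An infinite path is given by its state sequence \<open>s\<close> and its input sequence \<open>u\<close>.\<close>

definition infinite_path :: "('s, 'u, 'p) wts \<Rightarrow> (nat \<Rightarrow> 's) \<Rightarrow> (nat \<Rightarrow> 'u) \<Rightarrow> bool" where
  "infinite_path T s u \<longleftrightarrow>
     s 0 \<in> wts_init T \<and> (\<forall>i. (s i, u i, s (Suc i)) \<in> wts_trans T)"

definition inf_prefix :: "(nat \<Rightarrow> 's) \<Rightarrow> (nat \<Rightarrow> 'u) \<Rightarrow> nat \<Rightarrow> ('s, 'u) fpath" where
  "inf_prefix s u i = (s 0, map (\<lambda>j. (u j, s (Suc j))) [0..<i])"

definition property_over :: "'p set \<Rightarrow> 'p list set \<Rightarrow> bool" where
  "property_over P \<Phi> \<longleftrightarrow> \<Phi> \<subseteq> lists P"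

type_synonym ('s, 'u) strategy = "('s, 'u) fpath \<rightharpoonup> 'u"

definition is_strategy :: "('s, 'u, 'p) wts \<Rightarrow> ('s, 'u) strategy \<Rightarrow> bool" where
  "is_strategy T \<sigma> \<longleftrightarrow>
     dom \<sigma> \<subseteq> paths T \<and>
     (\<forall>\<zeta> u. \<sigma> \<zeta> = Some u \<longrightarrow> u \<in> enabled T (last (path_states \<zeta>)))"

definition conforms :: "('s, 'u, 'p) wts \<Rightarrow> ('s, 'u) strategy \<Rightarrow> ('s, 'u) fpath \<Rightarrow> bool" where
  "conforms T \<sigma> \<zeta> \<longleftrightarrow>
     \<zeta> \<in> paths T \<and>
     (\<forall>i < path_length \<zeta>. \<sigma> (path_prefix i \<zeta>) = Some (path_inputs \<zeta> ! i))"

definition inf_conforms ::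
  "('s, 'u, 'p) wts \<Rightarrow> ('s, 'u) strategy \<Rightarrow> (nat \<Rightarrow> 's) \<Rightarrow> (nat \<Rightarrow> 'u) \<Rightarrow> bool" where
  "inf_conforms T \<sigma> s u \<longleftrightarrow>
     infinite_path T s u \<and> (\<forall>i. \<sigma> (inf_prefix s u i) = Some (u i))"

definition max_conforms :: "('s, 'u, 'p) wts \<Rightarrow> ('s, 'u) strategy \<Rightarrow> ('s, 'u) fpath \<Rightarrow> bool" where
  "max_conforms T \<sigma> \<zeta> \<longleftrightarrow>
     conforms T \<sigma> \<zeta> \<and> \<not> (\<exists>u s. conforms T \<sigma> (path_extend \<zeta> u s))"

definition max_paths :: "('s, 'u, 'p) wts \<Rightarrow> ('s, 'u) strategy \<Rightarrow> 's \<Rightarrow> ('s, 'u) fpath set" where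
  "max_paths T \<sigma> s\<^sub>0 = {\<zeta>. max_conforms T \<sigma> \<zeta> \<and> fst \<zeta> = s\<^sub>0}"

text \<open>As in the definition of \<open>Str\<close>, infinite conforming paths are excluded from
  every initial state, not only from the state the strategy is supposed to win from.\<close>

definition terminating_strategies :: "('s, 'u, 'p) wts \<Rightarrow> ('s, 'u) strategy set" where
  "terminating_strategies T = {\<sigma>. is_strategy T \<sigma> \<and> \<not> (\<exists>s u. inf_conforms T \<sigma> s u)}"

definition winning ::
  "('s, 'u, 'p) wts \<Rightarrow> ('s, 'u) strategy \<Rightarrow> 's \<Rightarrow> 'p list set \<Rightarrow> bool" where
  "winning T \<sigma> s\<^sub>0 \<Phi> \<longleftrightarrow>
     \<sigma> \<in> terminating_strategies T \<and> trace T ` max_paths T \<sigma> s\<^sub>0 \<subseteq> \<Phi>"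

text \<open>Suprema and infima are taken in the extended reals, so an unbounded set of path
  costs has supremum \<open>\<infinity>\<close>, and the infimum over the empty set of strategies is \<open>\<infinity>\<close>.
  For a winning strategy and an initial state \<open>s\<^sub>0\<close>, the set \<open>max_paths T \<sigma> s\<^sub>0\<close> is never
  empty, so the supremum of the empty set plays no role.\<close>

definition strategy_cost :: "('s, 'u, 'p) wts \<Rightarrow> ('s, 'u) strategy \<Rightarrow> 's \<Rightarrow> ereal" where
  "strategy_cost T \<sigma> s\<^sub>0 = (SUP \<zeta> \<in> max_paths T \<sigma> s\<^sub>0. ereal (path_cost T \<zeta>))"

definition optimal_cost :: "('s, 'u, 'p) wts \<Rightarrow> 's \<Rightarrow> 'p list set \<Rightarrow> ereal" where
  "optimal_cost T s\<^sub>0 \<Phi> = (INF \<sigma> \<in> {\<sigma>. winning T \<sigma> s\<^sub>0 \<Phi>}. strategy_cost T \<sigma> s\<^sub>0)"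

definition simulation ::
  "('s1 \<times> 's2) set \<Rightarrow> ('s1 \<times> 'u1 \<times> 's2 \<times> 'u2) set \<Rightarrow>
   ('s1, 'u1, 'p) wts \<Rightarrow> ('s2, 'u2, 'p) wts \<Rightarrow> bool" where
  "simulation \<alpha> \<beta> T\<^sub>1 T\<^sub>2 \<longleftrightarrow>
     \<alpha> \<subseteq> wts_states T\<^sub>1 \<times> wts_states T\<^sub>2 \<and>
     \<beta> \<subseteq> wts_states T\<^sub>1 \<times> wts_inputs T\<^sub>1 \<times> wts_states T\<^sub>2 \<times> wts_inputs T\<^sub>2 \<and>
     (\<forall>(s\<^sub>1, s\<^sub>2) \<in> \<alpha>. wts_label T\<^sub>1 s\<^sub>1 = wts_label T\<^sub>2 s\<^sub>2) \<and>
     (\<forall>s\<^sub>1 \<in> wts_init T\<^sub>1. \<exists>s\<^sub>2 \<in> wts_init T\<^sub>2. (s\<^sub>1, s\<^sub>2) \<in> \<alpha>) \<and>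
     (\<forall>(s\<^sub>1, s\<^sub>2) \<in> \<alpha>. \<forall>u\<^sub>2 \<in> enabled T\<^sub>2 s\<^sub>2. \<exists>u\<^sub>1 \<in> enabled T\<^sub>1 s\<^sub>1.
        (s\<^sub>1, u\<^sub>1, s\<^sub>2, u\<^sub>2) \<in> \<beta> \<and>
        (\<forall>s\<^sub>1'. (s\<^sub>1, u\<^sub>1, s\<^sub>1') \<in> wts_trans T\<^sub>1 \<longrightarrow>
           (\<exists>s\<^sub>2'. (s\<^sub>2, u\<^sub>2, s\<^sub>2') \<in> wts_trans T\<^sub>2 \<and> (s\<^sub>1', s\<^sub>2') \<in> \<alpha> \<and>
              wts_cost T\<^sub>1 (s\<^sub>1, u\<^sub>1, s\<^sub>1') \<le> wts_cost T\<^sub>2 (s\<^sub>2, u\<^sub>2, s\<^sub>2'))))"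

end

theory Submission imports Defs begin

text \<open>
  A winning strategy for \<open>T\<^sub>2\<close> is transferred to \<open>T\<^sub>1\<close> by playing both systems in lockstep.
  Alongside the path \<open>\<zeta>\<close> produced so far in \<open>T\<^sub>1\<close>, the controller maintains a \<^emph>\<open>shadow\<close>: a path
  of \<open>T\<^sub>2\<close> that conforms to the given strategy \<open>\<sigma>\<^sub>2\<close> and whose states are \<open>\<alpha>\<close>-related to those of
  \<open>\<zeta>\<close>. It asks \<open>\<sigma>\<^sub>2\<close> for an input after the shadow, lets the simulation turn that input into an
  input of \<open>T\<^sub>1\<close>, and, once \<open>T\<^sub>1\<close> has resolved its nondeterminism, lets the simulation choose a
  transition of \<open>T\<^sub>2\<close> that is at least as expensive and extends the shadow. The shadow is a
  function of \<open>\<zeta>\<close>, because all choices are fixed in advance, so this recipe is a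
  strategy \<open>\<sigma>\<^sub>1\<close>.

  Related states carry the same label, so \<open>\<zeta>\<close> and its shadow have the same trace, and
  the cost of \<open>\<zeta>\<close> is at most that of the shadow (\<open>shadow_invariant\<close>). The strategy \<open>\<sigma>\<^sub>1\<close> stops
  exactly when \<open>\<sigma>\<^sub>2\<close> stops on the shadow, so maximal paths have maximal shadows
  (\<open>max_paths_shadow\<close>); this yields both the property and the cost bound. Shadows of longer
  prefixes extend those of shorter ones, so an infinite path conforming to \<open>\<sigma>\<^sub>1\<close> would have an
  infinite shadow conforming to \<open>\<sigma>\<^sub>2\<close> (\<open>inf_conforms_shadow\<close>), which does not exist.
\<close>

section \<open>Paths grown one step at a time\<close>

lemma path_states_nonempty [simp]: "path_states \<zeta> \<noteq> []"
  by (simp add: path_states_def)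

lemma fst_path_extend [simp]: "fst (path_extend \<zeta> u s) = fst \<zeta>"
  by (simp add: path_extend_def)

lemma path_states_path_extend [simp]: "path_states (path_extend \<zeta> u s) = path_states \<zeta> @ [s]"
  by (simp add: path_states_def path_extend_def)

lemma path_inputs_path_extend: "path_inputs (path_extend \<zeta> u s) = path_inputs \<zeta> @ [u]"
  by (simp add: path_inputs_def path_extend_def)

lemma path_length_path_extend [simp]: "path_length (path_extend \<zeta> u s) = Suc (path_length \<zeta>)"
  by (simp add: path_length_def path_extend_def)

lemma length_path_states: "length (path_states \<zeta>) = Suc (path_length \<zeta>)"
  by (simp add: path_states_def path_length_def)

lemma length_path_inputs: "length (path_inputs \<zeta>) = path_length \<zeta>"
  by (simp add: path_inputs_def path_length_def)

lemma path_step_path_extend_less: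
  "i < path_length \<zeta> \<Longrightarrow> path_step (path_extend \<zeta> u s) i = path_step \<zeta> i"
  by (simp add: path_step_def path_inputs_path_extend nth_append length_path_states
      length_path_inputs)

lemma path_step_path_extend_last:
  "path_step (path_extend \<zeta> u s) (path_length \<zeta>) = (last (path_states \<zeta>), u, s)"
  by (simp add: path_step_def path_inputs_path_extend nth_append length_path_states
      length_path_inputs last_conv_nth)

lemma path_prefix_path_extend:
  "i \<le> path_length \<zeta> \<Longrightarrow> path_prefix i (path_extend \<zeta> u s) = path_prefix i \<zeta>"
  by (simp add: path_prefix_def path_extend_def path_length_def)

lemma path_prefix_path_length [simp]: "path_prefix (path_length \<zeta>) \<zeta> = \<zeta>"
  by (simp add: path_prefix_def path_length_def)

lemma path_induct [case_names single extend]: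
  assumes "\<And>s. Q (s, [])" and "\<And>\<zeta> u s. Q \<zeta> \<Longrightarrow> Q (path_extend \<zeta> u s)"
  shows "Q \<zeta>"
proof -
  have "Q (r, xs)" for r xs
  proof (induction xs rule: rev_induct)
    case (snoc x xs)
    then show ?case using assms(2)[of "(r, xs)" "fst x" "snd x"] by (simp add: path_extend_def)
  qed (rule assms(1))
  then show ?thesis by (cases \<zeta>) simp
qed

lemma single_in_paths: "(s, []) \<in> paths T \<longleftrightarrow> s \<in> wts_init T"
  by (simp add: paths_def path_length_def)

lemma path_extend_in_paths:
  "path_extend \<zeta> u s \<in> paths T \<longleftrightarrow>
     \<zeta> \<in> paths T \<and> (last (path_states \<zeta>), u, s) \<in> wts_trans T"
  by (auto simp: paths_def less_Suc_eq path_step_path_extend_less path_step_path_extend_last)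

lemma conforms_single: "conforms T \<sigma> (s, []) \<longleftrightarrow> s \<in> wts_init T"
  by (simp add: conforms_def single_in_paths path_length_def)

lemma conforms_path_extend:
  "conforms T \<sigma> (path_extend \<zeta> u s) \<longleftrightarrow>
     conforms T \<sigma> \<zeta> \<and> (last (path_states \<zeta>), u, s) \<in> wts_trans T \<and> \<sigma> \<zeta> = Some u"
  by (auto simp: conforms_def path_extend_in_paths less_Suc_eq path_prefix_path_extend
      path_inputs_path_extend nth_append length_path_inputs)

lemma trace_path_extend: "trace T (path_extend \<zeta> u s) = trace T \<zeta> @ [wts_label T s]"
  by (simp add: trace_def)

lemma path_cost_path_extend:
  "path_cost T (path_extend \<zeta> u s) = path_cost T \<zeta> + wts_cost T (last (path_states \<zeta>), u, s)"
  by (simp add: path_cost_def path_step_path_extend_less path_step_path_extend_last)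

lemma strategy_enabled:
  "is_strategy T \<sigma> \<Longrightarrow> \<sigma> \<zeta> = Some u \<Longrightarrow> u \<in> enabled T (last (path_states \<zeta>))"
  unfolding is_strategy_def by blast

text \<open>A strategy only proposes enabled inputs, so the one way in which a conforming path can fail
  to have a conforming extension is that the strategy is undefined on it.\<close>

lemma max_conforms_iff:
  assumes "is_strategy T \<sigma>"
  shows "max_conforms T \<sigma> \<zeta> \<longleftrightarrow> conforms T \<sigma> \<zeta> \<and> \<sigma> \<zeta> = None"
  using strategy_enabled[OF assms]
  by (cases "\<sigma> \<zeta>") (auto simp: max_conforms_def conforms_path_extend enabled_def)

lemma inf_prefix_0: "inf_prefix s u 0 = (s 0, [])"
  by (simp add: inf_prefix_def)

lemma inf_prefix_Suc: "inf_prefix s u (Suc i) = path_extend (inf_prefix s u i) (u i) (s (Suc i))"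
  by (simp add: inf_prefix_def path_extend_def)

lemma last_path_states_inf_prefix [simp]: "last (path_states (inf_prefix s u i)) = s i"
  by (cases i) (simp_all add: inf_prefix_0 inf_prefix_Suc path_states_def[of "(_, [])"])

lemma conforms_inf_prefix: "inf_conforms T \<sigma> s u \<Longrightarrow> conforms T \<sigma> (inf_prefix s u i)"
  by (induction i) (auto simp: inf_prefix_0 inf_prefix_Suc conforms_single conforms_path_extend
      inf_conforms_def infinite_path_def)

section \<open>Transferring a strategy along a simulation\<close>

locale strategy_transfer =
  fixes T\<^sub>1 :: "('s1, 'u1, 'p) wts" and T\<^sub>2 :: "('s2, 'u2, 'p) wts"
    and \<alpha> :: "('s1 \<times> 's2) set" and \<beta> :: "('s1 \<times> 'u1 \<times> 's2 \<times> 'u2) set"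
    and \<sigma>\<^sub>2 :: "('s2, 'u2) strategy" and s\<^sub>0 :: 's1 and s\<^sub>0' :: 's2
  assumes sim: "simulation \<alpha> \<beta> T\<^sub>1 T\<^sub>2"
    and strategy\<^sub>2: "is_strategy T\<^sub>2 \<sigma>\<^sub>2"
    and start_related: "(s\<^sub>0, s\<^sub>0') \<in> \<alpha>"
    and start_init: "s\<^sub>0' \<in> wts_init T\<^sub>2"
begin

definition matches :: "'s1 \<times> 'u1 \<times> 's1 \<Rightarrow> 's2 \<times> 'u2 \<times> 's2 \<Rightarrow> bool" where
  "matches e\<^sub>1 e\<^sub>2 \<longleftrightarrow> e\<^sub>2 \<in> wts_trans T\<^sub>2 \<and> (snd (snd e\<^sub>1), snd (snd e\<^sub>2)) \<in> \<alpha> \<and>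
     wts_cost T\<^sub>1 e\<^sub>1 \<le> wts_cost T\<^sub>2 e\<^sub>2"

definition answers :: "'s1 \<Rightarrow> 's2 \<Rightarrow> 'u2 \<Rightarrow> 'u1 \<Rightarrow> bool" where
  "answers s\<^sub>1 s\<^sub>2 u\<^sub>2 u\<^sub>1 \<longleftrightarrow> u\<^sub>1 \<in> enabled T\<^sub>1 s\<^sub>1 \<and>
     (\<forall>s\<^sub>1'. (s\<^sub>1, u\<^sub>1, s\<^sub>1') \<in> wts_trans T\<^sub>1 \<longrightarrow> (\<exists>s\<^sub>2'. matches (s\<^sub>1, u\<^sub>1, s\<^sub>1') (s\<^sub>2, u\<^sub>2, s\<^sub>2')))"

text \<open>The shadow is computed by a fold over the steps of the path. The \<open>T\<^sub>1\<close>-state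
  reached so far is carried along because the choice of the next shadow state depends on
  the whole \<open>T\<^sub>1\<close>-transition. On paths that do not follow the transferred strategy the value is
  arbitrary.\<close>

definition shadow_step ::
  "'s1 \<times> ('s2, 'u2) fpath \<Rightarrow> 'u1 \<times> 's1 \<Rightarrow> 's1 \<times> ('s2, 'u2) fpath" where
  "shadow_step = (\<lambda>(s\<^sub>1, \<xi>) (u\<^sub>1, s\<^sub>1').
     let u\<^sub>2 = the (\<sigma>\<^sub>2 \<xi>) in
     (s\<^sub>1', path_extend \<xi> u\<^sub>2
        (SOME s\<^sub>2'. matches (s\<^sub>1, u\<^sub>1, s\<^sub>1') (last (path_states \<xi>), u\<^sub>2, s\<^sub>2'))))"

definition shadow :: "('s1, 'u1) fpath \<Rightarrow> ('s2, 'u2) fpath" where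
  "shadow \<zeta> = snd (foldl shadow_step (fst \<zeta>, (s\<^sub>0', [])) (snd \<zeta>))"

text \<open>The guard \<open>(last (path_states \<zeta>), last (path_states (shadow \<zeta>))) \<in> \<alpha>\<close> discards the paths with
  a meaningless shadow: there the simulation need not offer an enabled input, and the result might not
  be a strategy. The guard \<open>fst \<zeta> = s\<^sub>0\<close> makes the strategy stop at once from every other initial
  state, since infinite conforming paths are forbidden from all of them.\<close>

definition transferred :: "('s1, 'u1) strategy" where
  "transferred \<zeta> =
     (if \<zeta> \<in> paths T\<^sub>1 \<and> fst \<zeta> = s\<^sub>0 \<and>
         (last (path_states \<zeta>), last (path_states (shadow \<zeta>))) \<in> \<alpha>
      then map_option
        (\<lambda>u\<^sub>2. SOME u\<^sub>1. answers (last (path_states \<zeta>)) (last (path_states (shadow \<zeta>))) u\<^sub>2 u\<^sub>1)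
        (\<sigma>\<^sub>2 (shadow \<zeta>))
      else None)"

lemma shadow_single: "shadow (s, []) = (s\<^sub>0', [])"
  by (simp add: shadow_def)

lemma shadow_path_extend:
  "shadow (path_extend \<zeta> u s) =
     path_extend (shadow \<zeta>) (the (\<sigma>\<^sub>2 (shadow \<zeta>)))
       (SOME s\<^sub>2'. matches (last (path_states \<zeta>), u, s)
                     (last (path_states (shadow \<zeta>)), the (\<sigma>\<^sub>2 (shadow \<zeta>)), s\<^sub>2'))"
proof -
  have current: "fst (foldl shadow_step (fst \<zeta>, (s\<^sub>0', [])) (snd \<zeta>)) = last (path_states \<zeta>)" for \<zeta>
    by (induction \<zeta> rule: path_induct)
      (simp_all add: path_states_def path_extend_def shadow_step_def Let_def split_def)
  show ?thesis
    by (simp add: shadow_def shadow_step_def path_extend_def[of \<zeta>] Let_def split_def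
        flip: current)
qed

lemma fst_shadow: "fst (shadow \<zeta>) = s\<^sub>0'"
  by (induction \<zeta> rule: path_induct) (simp_all add: shadow_single shadow_path_extend)

lemma label_eq_if_related: "(s\<^sub>1, s\<^sub>2) \<in> \<alpha> \<Longrightarrow> wts_label T\<^sub>1 s\<^sub>1 = wts_label T\<^sub>2 s\<^sub>2"
  using sim unfolding simulation_def by fast

lemma ex_answer:
  assumes "(s\<^sub>1, s\<^sub>2) \<in> \<alpha>" and "u\<^sub>2 \<in> enabled T\<^sub>2 s\<^sub>2"
  shows "\<exists>u\<^sub>1. answers s\<^sub>1 s\<^sub>2 u\<^sub>2 u\<^sub>1"
proof -
  have "\<forall>(s\<^sub>1, s\<^sub>2) \<in> \<alpha>. \<forall>u\<^sub>2 \<in> enabled T\<^sub>2 s\<^sub>2. \<exists>u\<^sub>1. answers s\<^sub>1 s\<^sub>2 u\<^sub>2 u\<^sub>1"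
    using sim unfolding simulation_def answers_def matches_def fst_conv snd_conv by fast
  with assms show ?thesis by fast
qed

lemma transferred_SomeD:
  assumes "transferred \<zeta> = Some u\<^sub>1"
  obtains u\<^sub>2 where "\<zeta> \<in> paths T\<^sub>1" and "fst \<zeta> = s\<^sub>0" and "\<sigma>\<^sub>2 (shadow \<zeta>) = Some u\<^sub>2"
    and "answers (last (path_states \<zeta>)) (last (path_states (shadow \<zeta>))) u\<^sub>2 u\<^sub>1"
proof -
  let ?s\<^sub>1 = "last (path_states \<zeta>)" and ?s\<^sub>2 = "last (path_states (shadow \<zeta>))"
  from assms obtain u\<^sub>2 where path: "\<zeta> \<in> paths T\<^sub>1" "fst \<zeta> = s\<^sub>0" and related: "(?s\<^sub>1, ?s\<^sub>2) \<in> \<alpha>"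
    and u\<^sub>2: "\<sigma>\<^sub>2 (shadow \<zeta>) = Some u\<^sub>2" and u\<^sub>1: "u\<^sub>1 = (SOME u\<^sub>1. answers ?s\<^sub>1 ?s\<^sub>2 u\<^sub>2 u\<^sub>1)"
    by (auto simp: transferred_def split: if_splits)
  have "u\<^sub>2 \<in> enabled T\<^sub>2 ?s\<^sub>2" using strategy\<^sub>2 u\<^sub>2 by (rule strategy_enabled)
  with related have "answers ?s\<^sub>1 ?s\<^sub>2 u\<^sub>2 u\<^sub>1" unfolding u\<^sub>1 by (rule someI_ex[OF ex_answer])
  with path u\<^sub>2 show thesis by (rule that)
qed

lemma is_strategy_transferred: "is_strategy T\<^sub>1 transferred"
  unfolding is_strategy_def
proof (intro conjI allI impI subsetI)
  show "\<zeta> \<in> paths T\<^sub>1" if "\<zeta> \<in> dom transferred" for \<zeta>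
    using that by (auto elim: transferred_SomeD)
  show "u \<in> enabled T\<^sub>1 (last (path_states \<zeta>))" if "transferred \<zeta> = Some u" for \<zeta> u
    using that by (auto simp: answers_def elim: transferred_SomeD)
qed

text \<open>One round of the lockstep play: the proposed input is a genuine answer to \<open>\<sigma>\<^sub>2\<close>, hence every
  reaction of \<open>T\<^sub>1\<close> to it can be matched and the choice in the shadow picks such a match.\<close>

lemma shadow_path_extendE:
  assumes "transferred \<zeta> = Some u" and "(last (path_states \<zeta>), u, s) \<in> wts_trans T\<^sub>1"
  obtains u\<^sub>2 s\<^sub>2 where "\<sigma>\<^sub>2 (shadow \<zeta>) = Some u\<^sub>2"
    and "shadow (path_extend \<zeta> u s) = path_extend (shadow \<zeta>) u\<^sub>2 s\<^sub>2"
    and "matches (last (path_states \<zeta>), u, s) (last (path_states (shadow \<zeta>)), u\<^sub>2, s\<^sub>2)"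
proof -
  from assms(1) obtain u\<^sub>2 where u\<^sub>2: "\<sigma>\<^sub>2 (shadow \<zeta>) = Some u\<^sub>2"
    and "answers (last (path_states \<zeta>)) (last (path_states (shadow \<zeta>))) u\<^sub>2 u"
    by (rule transferred_SomeD)
  with assms(2) have
    "\<exists>s\<^sub>2. matches (last (path_states \<zeta>), u, s) (last (path_states (shadow \<zeta>)), u\<^sub>2, s\<^sub>2)"
    by (simp add: answers_def)
  from someI_ex[OF this] show thesis
    by (intro that[OF u\<^sub>2]) (simp_all add: shadow_path_extend u\<^sub>2)
qed

text \<open>The invariant of the lockstep play. Relatedness of the two last states is what
  keeps the induction going; the other conjuncts are its harvest.\<close>

lemma shadow_invariant:
  assumes "conforms T\<^sub>1 transferred \<zeta>" and "fst \<zeta> = s\<^sub>0"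
  shows "conforms T\<^sub>2 \<sigma>\<^sub>2 (shadow \<zeta>) \<and>
    (last (path_states \<zeta>), last (path_states (shadow \<zeta>))) \<in> \<alpha> \<and>
    trace T\<^sub>1 \<zeta> = trace T\<^sub>2 (shadow \<zeta>) \<and> path_cost T\<^sub>1 \<zeta> \<le> path_cost T\<^sub>2 (shadow \<zeta>)"
  using assms
proof (induction \<zeta> rule: path_induct)
  case (single s)
  then show ?case
    using start_related start_init label_eq_if_related[OF start_related]
    by (simp add: shadow_single conforms_single path_states_def trace_def path_cost_def
        path_length_def)
next
  case (extend \<zeta> u s)
  then have conf: "conforms T\<^sub>1 transferred \<zeta>" and "transferred \<zeta> = Some u"
    and "(last (path_states \<zeta>), u, s) \<in> wts_trans T\<^sub>1"
    by (simp_all add: conforms_path_extend)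
  from this(2,3) obtain u\<^sub>2 s\<^sub>2 where "\<sigma>\<^sub>2 (shadow \<zeta>) = Some u\<^sub>2"
    and "shadow (path_extend \<zeta> u s) = path_extend (shadow \<zeta>) u\<^sub>2 s\<^sub>2"
    and "matches (last (path_states \<zeta>), u, s) (last (path_states (shadow \<zeta>)), u\<^sub>2, s\<^sub>2)"
    by (rule shadow_path_extendE)
  with extend conf show ?case
    by (auto simp: matches_def conforms_path_extend trace_path_extend path_cost_path_extend
        label_eq_if_related intro: add_mono)
qed

lemma max_paths_shadow:
  assumes "\<zeta> \<in> max_paths T\<^sub>1 transferred s\<^sub>0"
  shows "shadow \<zeta> \<in> max_paths T\<^sub>2 \<sigma>\<^sub>2 s\<^sub>0'"
proof -
  from assms have conf: "conforms T\<^sub>1 transferred \<zeta>" "fst \<zeta> = s\<^sub>0" and "transferred \<zeta> = None"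
    by (simp_all add: max_paths_def max_conforms_iff[OF is_strategy_transferred])
  moreover have "\<zeta> \<in> paths T\<^sub>1" using conf(1) by (simp add: conforms_def)
  \<comment> \<open>By the invariant, \<open>\<zeta>\<close> passes every guard in the definition of the transferred strategy.\<close>
  ultimately have "\<sigma>\<^sub>2 (shadow \<zeta>) = None"
    using shadow_invariant[OF conf] by (simp add: transferred_def)
  with shadow_invariant[OF conf] show ?thesis
    by (simp add: max_paths_def max_conforms_iff[OF strategy\<^sub>2] fst_shadow)
qed

text \<open>Each prefix has a shadow that extends the shadow of the prefix before, so the shadows
  are the prefixes of one infinite path of \<open>T\<^sub>2\<close>.\<close>

lemma inf_conforms_shadow:
  assumes "inf_conforms T\<^sub>1 transferred s u"
  shows "\<exists>t v. inf_conforms T\<^sub>2 \<sigma>\<^sub>2 t v"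
proof -
  define \<xi> where "\<xi> i = shadow (inf_prefix s u i)" for i
  define t where "t i = last (path_states (\<xi> i))" for i
  define v where "v i = the (\<sigma>\<^sub>2 (\<xi> i))" for i
  have round: "\<sigma>\<^sub>2 (\<xi> i) = Some (v i) \<and> \<xi> (Suc i) = path_extend (\<xi> i) (v i) (t (Suc i)) \<and>
    (t i, v i, t (Suc i)) \<in> wts_trans T\<^sub>2" for i
  proof -
    have "transferred (inf_prefix s u i) = Some (u i)"
      and "(last (path_states (inf_prefix s u i)), u i, s (Suc i)) \<in> wts_trans T\<^sub>1"
      using assms by (simp_all add: inf_conforms_def infinite_path_def)
    then obtain u\<^sub>2 s\<^sub>2 where "\<sigma>\<^sub>2 (\<xi> i) = Some u\<^sub>2" and "\<xi> (Suc i) = path_extend (\<xi> i) u\<^sub>2 s\<^sub>2"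
      and "(t i, u\<^sub>2, s\<^sub>2) \<in> wts_trans T\<^sub>2"
      unfolding \<xi>_def t_def inf_prefix_Suc by (rule shadow_path_extendE) (simp add: matches_def)
    moreover from this(2) have "t (Suc i) = s\<^sub>2" by (simp add: t_def)
    ultimately show ?thesis by (simp add: v_def)
  qed
  have \<xi>_0: "\<xi> 0 = (s\<^sub>0', [])" by (simp add: \<xi>_def inf_prefix_0 shadow_single)
  then have t_0: "t 0 = s\<^sub>0'" by (simp add: t_def path_states_def)
  have "inf_prefix t v i = \<xi> i" for i
    by (induction i) (simp_all add: inf_prefix_0 inf_prefix_Suc \<xi>_0 t_0 round)
  then have "inf_conforms T\<^sub>2 \<sigma>\<^sub>2 t v"
    by (simp add: inf_conforms_def infinite_path_def t_0 start_init round)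
  then show ?thesis by blast
qed

lemma winning_transferred:
  assumes "winning T\<^sub>2 \<sigma>\<^sub>2 s\<^sub>0' \<Phi>"
  shows "winning T\<^sub>1 transferred s\<^sub>0 \<Phi>"
proof -
  have "transferred \<in> terminating_strategies T\<^sub>1"
    using assms is_strategy_transferred inf_conforms_shadow
    by (auto simp: winning_def terminating_strategies_def)
  moreover have "trace T\<^sub>1 \<zeta> \<in> \<Phi>" if \<zeta>: "\<zeta> \<in> max_paths T\<^sub>1 transferred s\<^sub>0" for \<zeta>
  proof -
    have "trace T\<^sub>1 \<zeta> = trace T\<^sub>2 (shadow \<zeta>)"
      using \<zeta> shadow_invariant by (simp add: max_paths_def max_conforms_def)
    then show ?thesis using assms max_paths_shadow[OF \<zeta>] by (auto simp: winning_def)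
  qed
  ultimately show ?thesis by (auto simp: winning_def)
qed

lemma strategy_cost_transferred_le:
  "strategy_cost T\<^sub>1 transferred s\<^sub>0 \<le> strategy_cost T\<^sub>2 \<sigma>\<^sub>2 s\<^sub>0'"
  unfolding strategy_cost_def
proof (rule SUP_mono)
  fix \<zeta> assume \<zeta>: "\<zeta> \<in> max_paths T\<^sub>1 transferred s\<^sub>0"
  then have "path_cost T\<^sub>1 \<zeta> \<le> path_cost T\<^sub>2 (shadow \<zeta>)"
    using shadow_invariant by (simp add: max_paths_def max_conforms_def)
  with max_paths_shadow[OF \<zeta>]
  show "\<exists>\<xi> \<in> max_paths T\<^sub>2 \<sigma>\<^sub>2 s\<^sub>0'. ereal (path_cost T\<^sub>1 \<zeta>) \<le> ereal (path_cost T\<^sub>2 \<xi>)"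
    by auto
qed

end

section \<open>Optimal costs\<close>

theorem theorem3:
  fixes T\<^sub>1 :: "('s1, 'u1, 'p) wts" and T\<^sub>2 :: "('s2, 'u2, 'p) wts"
    and P :: "'p set" and \<Phi> :: "'p list set"
    and \<alpha> :: "('s1 \<times> 's2) set" and \<beta> :: "('s1 \<times> 'u1 \<times> 's2 \<times> 'u2) set"
    and s\<^sub>0 :: 's1 and s\<^sub>0' :: 's2
  assumes "weighted_transition_system T\<^sub>1" and "weighted_transition_system T\<^sub>2"
    and "wts_props T\<^sub>1 = P" and "wts_props T\<^sub>2 = P"
    and "property_over P \<Phi>"
    and "simulation \<alpha> \<beta> T\<^sub>1 T\<^sub>2"
    and "(s\<^sub>0, s\<^sub>0') \<in> \<alpha>" and "s\<^sub>0 \<in> wts_init T\<^sub>1" and "s\<^sub>0' \<in> wts_init T\<^sub>2"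
  shows "(\<forall>\<sigma>\<^sub>2. winning T\<^sub>2 \<sigma>\<^sub>2 s\<^sub>0' \<Phi> \<longrightarrow>
            (\<exists>\<sigma>\<^sub>1. winning T\<^sub>1 \<sigma>\<^sub>1 s\<^sub>0 \<Phi> \<and>
                  strategy_cost T\<^sub>1 \<sigma>\<^sub>1 s\<^sub>0 \<le> strategy_cost T\<^sub>2 \<sigma>\<^sub>2 s\<^sub>0')) \<and>
         optimal_cost T\<^sub>1 s\<^sub>0 \<Phi> \<le> optimal_cost T\<^sub>2 s\<^sub>0' \<Phi>"
proof -
  have transfer: "\<exists>\<sigma>\<^sub>1. winning T\<^sub>1 \<sigma>\<^sub>1 s\<^sub>0 \<Phi> \<and>
      strategy_cost T\<^sub>1 \<sigma>\<^sub>1 s\<^sub>0 \<le> strategy_cost T\<^sub>2 \<sigma>\<^sub>2 s\<^sub>0'"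
    if win: "winning T\<^sub>2 \<sigma>\<^sub>2 s\<^sub>0' \<Phi>" for \<sigma>\<^sub>2
  proof -
    have "is_strategy T\<^sub>2 \<sigma>\<^sub>2" using win by (simp add: winning_def terminating_strategies_def)
    then interpret strategy_transfer T\<^sub>1 T\<^sub>2 \<alpha> \<beta> \<sigma>\<^sub>2 s\<^sub>0 s\<^sub>0'
      using assms by unfold_locales
    show ?thesis using winning_transferred[OF win] strategy_cost_transferred_le by blast
  qed
  moreover have "optimal_cost T\<^sub>1 s\<^sub>0 \<Phi> \<le> optimal_cost T\<^sub>2 s\<^sub>0' \<Phi>"
    unfolding optimal_cost_def by (rule INF_mono) (use transfer in blast)
  ultimately show ?thesis by blast
qed

end
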